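(* Let $r$, $l$, $m$ be positive integers with $l\ge 2$ and $m\ge 3$, let $G=P_l[K_{1,m}]$, and let $\delta$ and $\Delta$ denote the minimum and maximum degree of $G$. Then: (i) $\chi_r(G)=4$ for $1\le r\le 3$; (ii) for $4\le r\le \delta-1$, $\chi_r(G)=r+i$ for some integer $i\ge 2$; (iii) if $l=2$, then $\chi_r(G)=2m$ for $\delta\le r\le \Delta$; (iv) if $l\neq 2$, then $\chi_r(G)=2m$ for $r=\delta$; (v) if $l\neq 2$, then for $\delta+1\le r\le \Delta-m+1$, $\chi_r(G)=2m+i$ for some positive integer $i$; (vi) if $l\ge 3$, then $\chi_r(G)=3m$ for $\Delta-m+2\le r\le \Delta$.
   Context: All graphs are finite, simple, undirected. An $r$-dynamic $k$-coloring of a graph $G$ is a map $c:V(G)\to\{1,\dots,k\}$ such that $c(u)\neq c(v)$ for every edge $uv$, and for every vertex $v$, $|c(N(v))|\ge \min\{r,d(v)\}$, where $N(v)$ is the set of neighbours of $v$ and $d(v)$ its degree. The $r$-dynamic chromatic number $\chi_r(G)$ is the least $k$ for which an $r$-dynamic $k$-coloring exists. $P_l$ is the path on $l$ vertices. In this statement $K_{1,m}$ denotes the star with $m$ vertices in total: a center $s_0$ adjacent to the $m-1$ pendant vertices $s_1,\dots,s_{m-1}$. The lexicographic product $G_1[G_2]$ has vertex set $V(G_1)\times V(G_2)$, with $(g,h)$ adjacent to $(g',h')$ iff $gg'\in E(G_1)$, or $g=g'$ and $hh'\in E(G_2)$. *)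

theory Defs
  imports "Graph_Theory.Pair_Digraph"
begin

text \<open>
  Finite simple undirected graphs are the instances of the locale \<^locale>\<open>pair_graph\<close>: an
  edge \<open>uv\<close> is represented by the two arcs \<open>(u, v)\<close> and \<open>(v, u)\<close>. Since there are no
  parallel arcs, the degree of a vertex is its \<^const>\<open>out_degree\<close>.
\<close>

definition nbhd :: "'a pair_pre_digraph \<Rightarrow> 'a \<Rightarrow> 'a set" where
  "nbhd G v = {u \<in> pverts G. (v, u) \<in> parcs G}"

lemma (in pair_graph) out_degree_eq_card_nbhd: "out_degree (with_proj G) v = card (nbhd G v)"
proof -
  have "out_arcs (with_proj G) v = Pair v ` nbhd G v"
    by (auto simp: out_arcs_def nbhd_def dest: in_arcsD2)
  then show ?thesis
    by (simp add: out_degree_def card_image inj_on_def)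
qed

definition min_degree :: "'a pair_pre_digraph \<Rightarrow> nat" where
  "min_degree G = Min (out_degree (with_proj G) ` pverts G)"

definition max_degree :: "'a pair_pre_digraph \<Rightarrow> nat" where
  "max_degree G = Max (out_degree (with_proj G) ` pverts G)"

definition dynamic_coloring :: "nat \<Rightarrow> nat \<Rightarrow> 'a pair_pre_digraph \<Rightarrow> ('a \<Rightarrow> nat) \<Rightarrow> bool" where
  "dynamic_coloring r k G c \<longleftrightarrow>
     c ` pverts G \<subseteq> {1..k} \<and>
     (\<forall>(u, v) \<in> parcs G. c u \<noteq> c v) \<and>
     (\<forall>v \<in> pverts G. card (c ` nbhd G v) \<ge> min r (out_degree (with_proj G) v))"

definition dynamic_chromatic_number :: "nat \<Rightarrow> 'a pair_pre_digraph \<Rightarrow> nat" where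
  "dynamic_chromatic_number r G = (LEAST k. \<exists>c. dynamic_coloring r k G c)"

text \<open>The minimum is over a nonempty set: colour all vertices differently.\<close>

lemma (in pair_graph) ex_dynamic_coloring: "\<exists>k c. dynamic_coloring r k G c"
proof -
  obtain f :: "'a \<Rightarrow> nat" where f: "bij_betw f (pverts G) {0..<card (pverts G)}"
    using ex_bij_betw_finite_nat[OF pair_finite_verts] by blast
  define c where "c = Suc \<circ> f"
  have inj: "inj_on c (pverts G)"
    using f by (auto simp: c_def bij_betw_def inj_on_def)
  have "c ` pverts G \<subseteq> {1..card (pverts G)}"
    using bij_betwE[OF f] by (auto simp: c_def Suc_le_eq)
  moreover have "c u \<noteq> c v" if "(u, v) \<in> parcs G" for u v
    using that inj no_loops'[OF that] in_arcsD1[OF that] in_arcsD2[OF that]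
    by (auto dest: inj_onD)
  moreover have "card (c ` nbhd G v) = out_degree (with_proj G) v" for v
    using inj by (simp add: out_degree_eq_card_nbhd card_image nbhd_def inj_on_subset)
  ultimately have "dynamic_coloring r (card (pverts G)) G c"
    by (auto simp: dynamic_coloring_def)
  then show ?thesis by blast
qed

definition path_graph :: "nat \<Rightarrow> nat pair_pre_digraph" where
  "path_graph l = \<lparr> pverts = {..<l},
     parcs = {(i, j). i < l \<and> j < l \<and> (j = Suc i \<or> i = Suc j)} \<rparr>"

text \<open>The star has \<open>m\<close> vertices in total: centre \<open>0\<close> and pendant vertices \<open>1, \<dots>, m - 1\<close>.\<close>

definition star_graph :: "nat \<Rightarrow> nat pair_pre_digraph" where
  "star_graph m = \<lparr> pverts = {..<m},
     parcs = {(i, j). i < m \<and> j < m \<and> (i = 0 \<and> j \<noteq> 0 \<or> i \<noteq> 0 \<and> j = 0)} \<rparr>"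

definition lex_product ::
    "'a pair_pre_digraph \<Rightarrow> 'b pair_pre_digraph \<Rightarrow> ('a \<times> 'b) pair_pre_digraph" where
  "lex_product G H = \<lparr> pverts = pverts G \<times> pverts H,
     parcs = {((g, h), (g', h')).
       (g, h) \<in> pverts G \<times> pverts H \<and> (g', h') \<in> pverts G \<times> pverts H \<and>
       ((g, g') \<in> parcs G \<or> g = g' \<and> (h, h') \<in> parcs H)} \<rparr>"

lemma pair_graph_path_graph: "pair_graph (path_graph l)"
proof
  show "finite (parcs (path_graph l))"
    by (rule finite_subset[of _ "{..<l} \<times> {..<l}"]) (auto simp: path_graph_def)
qed (auto simp: path_graph_def symmetric_def sym_def)

lemma pair_graph_star_graph: "pair_graph (star_graph m)"
proof
  show "finite (parcs (star_graph m))"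
    by (rule finite_subset[of _ "{..<m} \<times> {..<m}"]) (auto simp: star_graph_def)
qed (auto simp: star_graph_def symmetric_def sym_def)

lemma pair_graph_lex_product:
  assumes "pair_graph G" "pair_graph H"
  shows "pair_graph (lex_product G H)"
proof -
  interpret G: pair_graph G by fact
  interpret H: pair_graph H by fact
  show ?thesis
  proof
    show "finite (parcs (lex_product G H))"
      by (rule finite_subset[of _ "(pverts G \<times> pverts H) \<times> (pverts G \<times> pverts H)"])
        (auto simp: lex_product_def G.pair_finite_verts H.pair_finite_verts)
  qed (auto simp: lex_product_def symmetric_def sym_def G.pair_finite_verts H.pair_finite_verts
        dest: G.no_loops' H.no_loops' G.arcs_symmetric H.arcs_symmetric)
qed

end

theory Submission
  imports Defs
begin

text \<open>
  Write \<open>A\<close> for the colour set of the second star of \<open>P\<^sub>l[K\<^sub>1\<^sub>,\<^sub>m]\<close> and \<open>B\<close> for the colour set of the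
  stars adjacent to it. They are disjoint. A pendant vertex sees only one colour besides those of
  the adjacent stars, so the dynamic condition at a pendant vertex of the first star bounds \<open>|A|\<close>
  from below by \<open>min r (m + 1) - 1\<close>, and at a pendant vertex of the second star it bounds \<open>|B|\<close> by
  \<open>min r d - 1\<close> with \<open>d = m + 1\<close> or \<open>d = 2 m + 1\<close>. All lower bounds for \<open>r \<ge> 4\<close> follow from
  \<open>k \<ge> |A| + |B|\<close>; for \<open>r \<le> 3\<close> the graph contains \<open>K\<^sub>4\<close>. The upper bounds come from colourings
  that are periodic along the path: with period two and two colours per star, or with period two
  or three and rainbow stars.
\<close>

section \<open>Dynamic chromatic number\<close>

lemma dynamic_chromatic_number_le:
  "dynamic_coloring r k G c \<Longrightarrow> dynamic_chromatic_number r G \<le> k"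
  unfolding dynamic_chromatic_number_def by (rule Least_le) blast

lemma (in pair_graph) ex_dynamic_chromatic_number_coloring:
  "\<exists>c. dynamic_coloring r (dynamic_chromatic_number r G) G c"
  unfolding dynamic_chromatic_number_def
  by (rule LeastI_ex) (rule ex_dynamic_coloring)

lemma dynamic_coloring_clique_le:
  assumes "dynamic_coloring r k G c" "K \<subseteq> pverts G"
    and "\<And>u v. u \<in> K \<Longrightarrow> v \<in> K \<Longrightarrow> u \<noteq> v \<Longrightarrow> (u, v) \<in> parcs G"
  shows "card K \<le> k"
proof -
  have "inj_on c K"
    using assms(1,3) by (fastforce simp: inj_on_def dynamic_coloring_def)
  then have "card K = card (c ` K)" by (simp add: card_image)
  also have "\<dots> \<le> card {1..k}"
    using assms(1,2) by (intro card_mono) (auto simp: dynamic_coloring_def)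
  finally show ?thesis by simp
qed

section \<open>Neighbourhoods\<close>

lemma (in pair_graph) finite_nbhd: "finite (nbhd G v)"
  by (simp add: nbhd_def pair_finite_verts)

lemma nbhd_lex_product:
  assumes "g \<in> pverts G" "h \<in> pverts H"
  shows "nbhd (lex_product G H) (g, h) = nbhd G g \<times> pverts H \<union> {g} \<times> nbhd H h"
  using assms by (auto simp: nbhd_def lex_product_def)

lemma card_nbhd_lex_product:
  assumes "pair_graph G" "pair_graph H" "g \<in> pverts G" "h \<in> pverts H"
  shows "card (nbhd (lex_product G H) (g, h)) =
    card (nbhd G g) * card (pverts H) + card (nbhd H h)"
proof -
  interpret G: pair_graph G by fact
  interpret H: pair_graph H by fact
  have "g \<notin> nbhd G g" by (auto simp: nbhd_def dest: G.no_loops')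
  then have "nbhd G g \<times> pverts H \<inter> {g} \<times> nbhd H h = {}" by auto
  then show ?thesis
    using assms(3,4)
    by (simp add: nbhd_lex_product card_Un_disjoint card_cartesian_product
        G.finite_nbhd H.finite_nbhd H.pair_finite_verts)
qed

lemma pverts_path_graph [simp]: "pverts (path_graph l) = {..<l}"
  by (simp add: path_graph_def)

lemma pverts_star_graph [simp]: "pverts (star_graph m) = {..<m}"
  by (simp add: star_graph_def)

lemma pverts_lex_product [simp]: "pverts (lex_product G H) = pverts G \<times> pverts H"
  by (simp add: lex_product_def)

lemma nbhd_path_graph:
  "i < l \<Longrightarrow> nbhd (path_graph l) i = {j. j < l \<and> (j = Suc i \<or> i = Suc j)}"
  by (auto simp: nbhd_def path_graph_def)

lemma card_nbhd_path_graph: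
  assumes "i < l"
  shows "card (nbhd (path_graph l) i) = of_bool (0 < i) + of_bool (Suc i < l)"
proof -
  have "nbhd (path_graph l) i =
      (if 0 < i then {i - 1} else {}) \<union> (if Suc i < l then {Suc i} else {})"
    using assms by (auto simp: nbhd_path_graph)
  then show ?thesis by (cases i) auto
qed

lemma nbhd_star_graph:
  "h < m \<Longrightarrow> nbhd (star_graph m) h = (if h = 0 then {1..<m} else {0})"
  by (auto simp: nbhd_def star_graph_def)

section \<open>Pendant vertices and lower bounds\<close>

text \<open>Only two leaves matter, \<open>g\<close> of \<open>G\<close> and \<open>h\<close> of
  \<open>H\<close>. Besides whole fibres over neighbours of the first coordinate, a vertex with
  second coordinate \<open>h\<close> sees a single vertex of its own fibre. This extra colour is
  lost once at \<open>(g, h)\<close> and once at \<open>(g', h)\<close>, hence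
  \<open>k + 2\<close>.\<close>

lemma dynamic_coloring_lex_product_pendant:
  assumes "pair_graph G" "pair_graph H"
    and c: "dynamic_coloring r k (lex_product G H) c"
    and g: "g \<in> pverts G" "nbhd G g = {g'}"
    and h: "h \<in> pverts H" "nbhd H h = {h'}"
  shows "min r (card (pverts H) + 1) + min r (card (nbhd G g') * card (pverts H) + 1) \<le> k + 2"
proof -
  interpret G: pair_graph G by fact
  interpret H: pair_graph H by fact
  interpret L: pair_graph "lex_product G H"
    using assms(1,2) by (rule pair_graph_lex_product)
  have g': "g' \<in> pverts G" using g by (auto simp: nbhd_def)
  define A where "A = c ` ({g'} \<times> pverts H)"
  define B where "B = c ` (nbhd G g' \<times> pverts H)"
  have fin: "finite A" "finite B"
    by (auto simp: A_def B_def H.pair_finite_verts G.finite_nbhd)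
  \<comment> \<open>Used twice: \<open>x = g\<close>, whose only neighbouring fibre carries
    \<open>A\<close>, and \<open>x = g'\<close>, whose neighbouring fibres carry
    \<open>B\<close>.\<close>
  have seen: "min r (card (nbhd G x) * card (pverts H) + 1) \<le>
      card (c ` (nbhd G x \<times> pverts H)) + 1" if "x \<in> pverts G" for x
  proof -
    have "min r (out_degree (with_proj (lex_product G H)) (x, h))
        \<le> card (c ` nbhd (lex_product G H) (x, h))"
      using c that h(1) by (auto simp: dynamic_coloring_def)
    also have "c ` nbhd (lex_product G H) (x, h) =
        insert (c (x, h')) (c ` (nbhd G x \<times> pverts H))"
      using that h by (auto simp: nbhd_lex_product)
    also have "card \<dots> \<le> card (c ` (nbhd G x \<times> pverts H)) + 1"
      by (simp add: card_insert_if H.pair_finite_verts G.finite_nbhd)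
    finally show ?thesis
      using that h assms(1,2) by (simp add: L.out_degree_eq_card_nbhd card_nbhd_lex_product)
  qed
  \<comment> \<open>Each vertex over \<open>g'\<close> is adjacent to every vertex over
    \<open>nbhd G g'\<close>.\<close>
  have "A \<inter> B = {}"
    using c g' by (fastforce simp: A_def B_def dynamic_coloring_def lex_product_def nbhd_def)
  then have "card A + card B = card (A \<union> B)"
    using fin by (simp add: card_Un_disjoint)
  also have "\<dots> \<le> card {1..k}"
    using c g' by (intro card_mono) (auto simp: A_def B_def dynamic_coloring_def nbhd_def)
  finally have "card A + card B \<le> k" by simp
  then show ?thesis
    using seen[OF g(1)] seen[OF g'] g(2) by (simp add: A_def B_def)
qed

section \<open>Products of a path and a star\<close>

abbreviation (input) path_star :: "nat \<Rightarrow> nat \<Rightarrow> (nat \<times> nat) pair_pre_digraph" where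
  "path_star l m \<equiv> lex_product (path_graph l) (star_graph m)"

lemma pair_graph_path_star: "pair_graph (path_star l m)"
  by (intro pair_graph_lex_product pair_graph_path_graph pair_graph_star_graph)

lemma out_degree_path_star:
  assumes "i < l" "h < m"
  shows "out_degree (with_proj (path_star l m)) (i, h) =
    (of_bool (0 < i) + of_bool (Suc i < l)) * m + (if h = 0 then m - 1 else 1)"
  using assms
  by (simp add: pair_graph.out_degree_eq_card_nbhd[OF pair_graph_path_star]
      card_nbhd_lex_product pair_graph_path_graph pair_graph_star_graph
      card_nbhd_path_graph nbhd_star_graph)

lemma min_degree_path_star:
  assumes "l \<ge> 2" "m \<ge> 3"
  shows "min_degree (path_star l m) = m + 1"
  unfolding min_degree_def
proof (rule Min_eqI)
  show "m + 1 \<in> out_degree (with_proj (path_star l m)) ` pverts (path_star l m)"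
    \<comment> \<open>A pendant vertex of an end star, which has only one adjacent star.\<close>
    using assms by (intro image_eqI[of _ _ "(0, 1)"]) (auto simp: out_degree_path_star)
qed (use assms in \<open>auto simp: out_degree_path_star\<close>)

lemma max_degree_path_star:
  assumes "l \<ge> 2" "m \<ge> 3"
  shows "max_degree (path_star l m) = (if l = 2 then 2 * m - 1 else 3 * m - 1)"
  unfolding max_degree_def
proof (rule Max_eqI)
  show "(if l = 2 then 2 * m - 1 else 3 * m - 1)
      \<in> out_degree (with_proj (path_star l m)) ` pverts (path_star l m)"
    \<comment> \<open>The centre of the second star, which has two adjacent stars as soon as
      \<open>l\<close> exceeds 2.\<close>
    using assms by (intro image_eqI[of _ _ "(1, 0)"]) (auto simp: out_degree_path_star)
qed (use assms in \<open>auto simp: out_degree_path_star\<close>)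

lemma path_star_lower_bound:
  assumes "l \<ge> 2" "m \<ge> 2" "dynamic_coloring r k (path_star l m) c"
  shows "min r (m + 1) + min r ((if l = 2 then m else 2 * m) + 1) \<le> k + 2"
proof -
  have "nbhd (path_graph l) 0 = {1}" "nbhd (star_graph m) 1 = {0}"
    using assms(1,2) by (auto simp: nbhd_path_graph nbhd_star_graph)
  then show ?thesis
    using dynamic_coloring_lex_product_pendant
      [OF pair_graph_path_graph pair_graph_star_graph assms(3), of 0 1 1 0] assms(1,2)
    by (auto simp: card_nbhd_path_graph split: if_splits)
qed

lemma path_star_ge_4:
  assumes "l \<ge> 2" "m \<ge> 2" "dynamic_coloring r k (path_star l m) c"
  shows "4 \<le> k"
proof -
  \<comment> \<open>An edge of the path times an edge of the star spans a complete graph on four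
    vertices.\<close>
  have "card ({0, 1} \<times> {0, 1} :: (nat \<times> nat) set) \<le> k"
    using assms(1,2)
    by (intro dynamic_coloring_clique_le[OF assms(3)])
      (auto simp: lex_product_def path_graph_def star_graph_def)
  then show ?thesis by (simp add: card_cartesian_product)
qed

section \<open>Periodic colourings\<close>

text \<open>Star \<open>i\<close> receives block \<open>i mod n\<close> of \<open>m\<close>
  consecutive colours. For \<open>h < m\<close>, quotient and remainder modulo \<open>m\<close>
  recover the block and \<open>h\<close>; \<open>Suc\<close> makes the colours start at 1.\<close>

definition periodic_coloring :: "nat \<Rightarrow> nat \<Rightarrow> nat \<times> nat \<Rightarrow> nat" where
  "periodic_coloring n m = (\<lambda>(i, h). Suc (m * (i mod n) + h))"

lemma periodic_coloring_eq_iff: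
  assumes "h < m" "h' < m"
  shows "periodic_coloring n m (i, h) = periodic_coloring n m (j, h') \<longleftrightarrow>
    i mod n = j mod n \<and> h = h'"
proof
  assume "periodic_coloring n m (i, h) = periodic_coloring n m (j, h')"
  then have eq: "m * (i mod n) + h = m * (j mod n) + h'"
    by (simp add: periodic_coloring_def)
  from arg_cong[OF eq, of "\<lambda>x. x div m"] have "i mod n = j mod n" using assms by simp
  with eq show "i mod n = j mod n \<and> h = h'" by simp
qed (simp add: periodic_coloring_def)

lemma periodic_coloring_range:
  assumes "n > 0" "h < m"
  shows "periodic_coloring n m (i, h) \<in> {1..n * m}"
proof -
  have "m * (i mod n) + h < m * Suc (i mod n)" using assms by simp
  also have "\<dots> \<le> m * n" using assms by (intro mult_le_mono2) (simp add: Suc_leI)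
  finally show ?thesis by (simp add: periodic_coloring_def mult.commute)
qed

lemma Suc_mod_neq: "n \<ge> 2 \<Longrightarrow> Suc i mod n \<noteq> i mod n"
  by (simp add: mod_Suc)

lemma periodic_coloring_proper:
  assumes "n \<ge> 2" "(u, v) \<in> parcs (path_star l m)"
  shows "periodic_coloring n m u \<noteq> periodic_coloring n m v"
  using assms Suc_mod_neq[OF assms(1)] Suc_mod_neq[OF assms(1), symmetric]
  by (auto simp: lex_product_def path_graph_def star_graph_def periodic_coloring_eq_iff)

lemma dynamic_coloring_periodic:
  assumes "n \<ge> 2"
    and "\<And>i h. i < l \<Longrightarrow> h < m \<Longrightarrow>
      min r (out_degree (with_proj (path_star l m)) (i, h))
      \<le> card (periodic_coloring n m ` nbhd (path_star l m) (i, h))"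
  shows "dynamic_coloring r (n * m) (path_star l m) (periodic_coloring n m)"
  unfolding dynamic_coloring_def
proof (intro conjI)
  show "periodic_coloring n m ` pverts (path_star l m) \<subseteq> {1..n * m}"
    using assms(1) periodic_coloring_range[of n] by fastforce
qed (use assms periodic_coloring_proper in auto)

text \<open>A neighbourhood meets at most three consecutive stars, or two if \<open>l = 2\<close>.
  These get different blocks, so the colouring is injective on it and every \<open>r\<close> is
  admissible.\<close>

lemma dynamic_coloring_periodic_rainbow:
  assumes "n \<ge> 2" "n \<ge> 3 \<or> l = 2"
  shows "dynamic_coloring r (n * m) (path_star l m) (periodic_coloring n m)"
proof (rule dynamic_coloring_periodic[OF assms(1)])
  fix i h assume ih: "i < l" "h < m"
  have mod: "j mod n = j' mod n \<longleftrightarrow> j = j'"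
    if "j \<in> {i - 1..Suc i}" "j' \<in> {i - 1..Suc i}" "j < l" "j' < l" for j j'
  proof -
    have "j = j'" if "j mod n = j' mod n" "j \<le> j'"
      "j \<in> {i - 1..Suc i}" "j' \<in> {i - 1..Suc i}" "j < l" "j' < l" for j j'
    proof (rule ccontr)
      assume "j \<noteq> j'"
      have "n dvd j' - j" using that by (metis mod_eq_dvd_iff_nat)
      \<comment> \<open>But \<open>j' - j\<close> is at most 2, and at most 1 if
        \<open>l = 2\<close>.\<close>
      then have "n \<le> j' - j" using \<open>j \<noteq> j'\<close> that(2) by (auto dest: dvd_imp_le)
      then show False using that assms by auto
    qed
    from this[of j j'] this[of j' j] show ?thesis using that by (metis nat_le_linear)
  qed
  have "inj_on (periodic_coloring n m) (nbhd (path_star l m) (i, h))"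
  proof (rule inj_onI)
    fix x y
    assume "x \<in> nbhd (path_star l m) (i, h)" "y \<in> nbhd (path_star l m) (i, h)"
      and eq: "periodic_coloring n m x = periodic_coloring n m y"
    then obtain j k j' k' where "x = (j, k)" "y = (j', k')" "k < m" "k' < m"
      "j \<in> {i - 1..Suc i}" "j' \<in> {i - 1..Suc i}" "j < l" "j' < l"
      using ih
      by (cases x, cases y)
        (auto simp: nbhd_lex_product nbhd_path_graph nbhd_star_graph split: if_splits)
    then show "x = y" using eq mod by (simp add: periodic_coloring_eq_iff)
  qed
  then show "min r (out_degree (with_proj (path_star l m)) (i, h))
      \<le> card (periodic_coloring n m ` nbhd (path_star l m) (i, h))"
    by (simp add: card_image pair_graph.out_degree_eq_card_nbhd[OF pair_graph_path_star])
qed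

text \<open>The part of a neighbourhood on which period-two colourings rely: one entire adjacent
  star, of opposite parity, and one vertex of the own star.\<close>

lemma nbhd_path_star_supset:
  assumes "l \<ge> 2" "m \<ge> 2" "i < l" "h < m"
  obtains j h' where "j mod 2 \<noteq> i mod 2" "h' < m"
    "insert (i, h') ({j} \<times> {..<m}) \<subseteq> nbhd (path_star l m) (i, h)"
proof
  \<comment> \<open>The preceding star, or for the first star the following one, present since
    \<open>l \<ge> 2\<close>.\<close>
  define j where "j = (if i = 0 then 1 else i - 1)"
  define h' :: nat where "h' = (if h = 0 then 1 else 0)"
  show "j mod 2 \<noteq> i mod 2" by (cases i) (auto simp: j_def mod_Suc)
  show "h' < m" using assms by (simp add: h'_def)
  show "insert (i, h') ({j} \<times> {..<m}) \<subseteq> nbhd (path_star l m) (i, h)"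
    using assms
    by (auto simp: nbhd_lex_product nbhd_path_graph nbhd_star_graph j_def h'_def)
qed

text \<open>Although the two stars next to an inner star share their colours, one of them shows
  \<open>m\<close> colours and the own star one more.\<close>

lemma dynamic_coloring_period_two:
  assumes "l \<ge> 2" "m \<ge> 2" "r \<le> m + 1"
  shows "dynamic_coloring r (2 * m) (path_star l m) (periodic_coloring 2 m)"
proof (rule dynamic_coloring_periodic)
  fix i h assume ih: "i < l" "h < m"
  let ?c = "periodic_coloring 2 m"
  obtain j h' where j: "j mod 2 \<noteq> i mod 2" "h' < m"
    "insert (i, h') ({j} \<times> {..<m}) \<subseteq> nbhd (path_star l m) (i, h)"
    using nbhd_path_star_supset[OF assms(1,2) ih] by metis
  have "inj_on ?c (insert (i, h') ({j} \<times> {..<m}))"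
    using j by (auto simp: inj_on_def periodic_coloring_eq_iff)
  then have "card (?c ` insert (i, h') ({j} \<times> {..<m})) = m + 1"
    using j by (subst card_image) (auto simp: card_insert_if card_cartesian_product)
  moreover have "card (?c ` insert (i, h') ({j} \<times> {..<m})) \<le> card (?c ` nbhd (path_star l m) (i, h))"
    using j by (intro card_mono image_mono finite_imageI
        pair_graph.finite_nbhd[OF pair_graph_path_star])
  ultimately show "min r (out_degree (with_proj (path_star l m)) (i, h))
      \<le> card (?c ` nbhd (path_star l m) (i, h))"
    using assms by simp
qed simp

text \<open>\<open>min h 1\<close> gives all pendant vertices of a star the same colour, so each
  star uses two colours. A vertex sees both colours of an adjacent star and one of its own.\<close>

lemma dynamic_coloring_four:
  assumes "l \<ge> 2" "m \<ge> 2" "r \<le> 3"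
  shows "dynamic_coloring r 4 (path_star l m) (\<lambda>(i, h). periodic_coloring 2 2 (i, min h 1))"
    (is "dynamic_coloring _ _ _ ?c")
  unfolding dynamic_coloring_def
proof (intro conjI ballI)
  show "?c ` pverts (path_star l m) \<subseteq> {1..4}"
    using periodic_coloring_range[of 2 _ 2] by fastforce
  show "case e of (u, v) \<Rightarrow> ?c u \<noteq> ?c v" if "e \<in> parcs (path_star l m)" for e
    using that Suc_mod_neq[of 2] Suc_mod_neq[of 2, symmetric]
    by (auto simp: lex_product_def path_graph_def star_graph_def periodic_coloring_eq_iff)
next
  fix v assume "v \<in> pverts (path_star l m)"
  then obtain i h where v: "v = (i, h)" and ih: "i < l" "h < m" by auto
  obtain j h' where j: "j mod 2 \<noteq> i mod 2"
    "insert (i, h') ({j} \<times> {..<m}) \<subseteq> nbhd (path_star l m) (i, h)"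
    using nbhd_path_star_supset[OF assms(1,2) ih] by metis
  have "inj_on ?c {(i, h'), (j, 0), (j, 1)}"
    using j(1) by (auto simp: inj_on_def periodic_coloring_eq_iff)
  then have "card (?c ` {(i, h'), (j, 0), (j, 1)}) = 3"
    using j(1) by (subst card_image) (auto simp: card_insert_if)
  moreover have "card (?c ` {(i, h'), (j, 0), (j, 1)}) \<le> card (?c ` nbhd (path_star l m) v)"
    using j(2) assms(2) unfolding v
    by (intro card_mono image_mono finite_imageI
        pair_graph.finite_nbhd[OF pair_graph_path_star]) auto
  ultimately show "min r (out_degree (with_proj (path_star l m)) v)
      \<le> card (?c ` nbhd (path_star l m) v)"
    using assms(3) by linarith
qed

theorem theorem2:
  fixes r l m :: nat
  assumes "r \<ge> 1" and "l \<ge> 2" and "m \<ge> 3"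
  defines "G \<equiv> lex_product (path_graph l) (star_graph m)"
  defines "\<delta> \<equiv> min_degree G"
  defines "\<Delta> \<equiv> max_degree G"
  shows
    "(1 \<le> r \<and> r \<le> 3 \<longrightarrow> dynamic_chromatic_number r G = 4) \<and>
     (4 \<le> r \<and> int r \<le> int \<delta> - 1 \<longrightarrow>
        (\<exists>i\<ge>2. dynamic_chromatic_number r G = r + i)) \<and>
     (l = 2 \<longrightarrow> \<delta> \<le> r \<and> r \<le> \<Delta> \<longrightarrow> dynamic_chromatic_number r G = 2 * m) \<and>
     (l \<noteq> 2 \<longrightarrow> r = \<delta> \<longrightarrow> dynamic_chromatic_number r G = 2 * m) \<and>
     (l \<noteq> 2 \<longrightarrow> \<delta> + 1 \<le> r \<and> int r \<le> int \<Delta> - int m + 1 \<longrightarrow>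
        (\<exists>i>0. dynamic_chromatic_number r G = 2 * m + i)) \<and>
     (l \<ge> 3 \<longrightarrow> int \<Delta> - int m + 2 \<le> int r \<and> r \<le> \<Delta> \<longrightarrow>
        dynamic_chromatic_number r G = 3 * m)"
proof -
  let ?\<chi> = "dynamic_chromatic_number r G"
  have \<delta>: "\<delta> = m + 1" and \<Delta>: "\<Delta> = (if l = 2 then 2 * m - 1 else 3 * m - 1)"
    using assms(2,3) by (simp_all add: \<delta>_def \<Delta>_def G_def min_degree_path_star max_degree_path_star)
  obtain c where c: "dynamic_coloring r ?\<chi> G c"
    using pair_graph.ex_dynamic_chromatic_number_coloring[OF pair_graph_path_star]
    unfolding G_def by blast
  have ge4: "4 \<le> ?\<chi>"
    using path_star_ge_4[of l m r ?\<chi> c] assms(2,3) c unfolding G_def by simp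
  have lower: "min r (m + 1) + min r ((if l = 2 then m else 2 * m) + 1) \<le> ?\<chi> + 2"
    using path_star_lower_bound[of l m r ?\<chi> c] assms(2,3) c unfolding G_def by simp
  have le4: "?\<chi> \<le> 4" if "r \<le> 3"
    using dynamic_chromatic_number_le[OF dynamic_coloring_four] that assms(2,3)
    unfolding G_def by simp
  \<comment> \<open>For \<open>l = 2\<close> period two is already rainbow, which covers every
    \<open>r\<close>.\<close>
  have le2m: "?\<chi> \<le> 2 * m" if "l = 2 \<or> r \<le> m + 1"
    using dynamic_chromatic_number_le[OF dynamic_coloring_period_two]
      dynamic_chromatic_number_le[OF dynamic_coloring_periodic_rainbow[of 2]] that assms(2,3)
    unfolding G_def by auto
  have le3m: "?\<chi> \<le> 3 * m"
    using dynamic_chromatic_number_le[OF dynamic_coloring_periodic_rainbow[of 3]]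
    unfolding G_def by simp
  show ?thesis
  proof (intro conjI impI)
    show "?\<chi> = 4" if "1 \<le> r \<and> r \<le> 3"
      using that ge4 le4 by simp
    show "\<exists>i\<ge>2. ?\<chi> = r + i" if "4 \<le> r \<and> int r \<le> int \<delta> - 1"
    proof -
      \<comment> \<open>Here \<open>r \<le> m\<close>, so both minima in \<open>lower\<close> equal
        \<open>r\<close>, and \<open>2 * r - 2 \<ge> r + 2\<close> because
        \<open>r \<ge> 4\<close>.\<close>
      have "r + 2 \<le> ?\<chi>" using that lower \<delta> by (auto split: if_splits)
      then show ?thesis by (metis add.assoc le_Suc_ex le_add1)
    qed
    show "?\<chi> = 2 * m" if "l = 2" "\<delta> \<le> r \<and> r \<le> \<Delta>"
      using that lower le2m \<delta> by simp
    show "?\<chi> = 2 * m" if "l \<noteq> 2" "r = \<delta>"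
      using that lower le2m \<delta> assms(3) by simp
    show "\<exists>i>0. ?\<chi> = 2 * m + i"
      if "l \<noteq> 2" "\<delta> + 1 \<le> r \<and> int r \<le> int \<Delta> - int m + 1"
    proof -
      have "r \<le> 2 * m" using that \<Delta> assms(3) by auto
      \<comment> \<open>The minima are \<open>m + 1\<close> and \<open>r\<close>, with
        \<open>r \<ge> m + 2\<close>.\<close>
      then have "2 * m < ?\<chi>" using that lower \<delta> by simp
      then show ?thesis using less_imp_add_positive by metis
    qed
    show "?\<chi> = 3 * m" if "l \<ge> 3" "int \<Delta> - int m + 2 \<le> int r \<and> r \<le> \<Delta>"
    proof -
      \<comment> \<open>Now both minima are saturated, at \<open>m + 1\<close> and
        \<open>2 * m + 1\<close>, with sum \<open>3 * m + 2\<close>.\<close>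
      have "2 * m + 1 \<le> r" using that \<Delta> assms(3) by auto
      then show ?thesis using that lower le3m by simp
    qed
  qed
qed

end
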